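(* Let $R$ be a compact topological ring (associative, Hausdorff, not necessarily unital and not necessarily commutative). Then $A(R) = N(R)$, where $A(R)$ denotes the sum of all left nil ideals of $R$ and $N(R)$ denotes the upper nilradical of $R$, i.e. the sum of all two-sided nil ideals of $R$.
   Context: All rings are associative, but are not assumed to be unital or commutative. A topological ring is a pair $(R,\mathcal{T})$ where $R$ is a ring and $\mathcal{T}$ is a Hausdorff topology on $R$ such that $(R,+,\mathcal{T})$ is a topological group and multiplication $R\times R\to R$ is continuous. It is compact if the topology $\mathcal{T}$ is compact. A left nil ideal is a left ideal all of whose elements are nilpotent; a two-sided nil ideal is a two-sided ideal all of whose elements are nilpotent. The sums of ideals are purely algebraic (sets of finite sums of elements of the ideals; no topological closure is taken). *)

theory Defs
  imports "HOL-Analysis.Analysis"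
begin

(* The library power (^) needs a unit, which class ring does not provide:
   pow_Suc x n is the (n + 1)-st power of x. *)
primrec pow_Suc :: "'a::semigroup_mult \<Rightarrow> nat \<Rightarrow> 'a" where
  "pow_Suc x 0 = x"
| "pow_Suc x (Suc n) = x * pow_Suc x n"

definition nilpotent :: "'a::ring \<Rightarrow> bool" where
  "nilpotent x \<longleftrightarrow> (\<exists>n. pow_Suc x n = 0)"

definition additive_subgroup :: "'a::ring set \<Rightarrow> bool" where
  "additive_subgroup I \<longleftrightarrow>
     0 \<in> I \<and> (\<forall>x\<in>I. \<forall>y\<in>I. x + y \<in> I) \<and> (\<forall>x\<in>I. - x \<in> I)"

definition left_ideal :: "'a::ring set \<Rightarrow> bool" where
  "left_ideal I \<longleftrightarrow> additive_subgroup I \<and> (\<forall>r. \<forall>x\<in>I. r * x \<in> I)"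

definition two_sided_ideal :: "'a::ring set \<Rightarrow> bool" where
  "two_sided_ideal I \<longleftrightarrow>
     additive_subgroup I \<and> (\<forall>r. \<forall>x\<in>I. r * x \<in> I) \<and> (\<forall>r. \<forall>x\<in>I. x * r \<in> I)"

definition left_nil_ideal :: "'a::ring set \<Rightarrow> bool" where
  "left_nil_ideal I \<longleftrightarrow> left_ideal I \<and> (\<forall>x\<in>I. nilpotent x)"

definition two_sided_nil_ideal :: "'a::ring set \<Rightarrow> bool" where
  "two_sided_nil_ideal I \<longleftrightarrow> two_sided_ideal I \<and> (\<forall>x\<in>I. nilpotent x)"

definition sum_of_ideals :: "'a::ring set set \<Rightarrow> 'a set" where
  "sum_of_ideals \<I> = {sum_list xs | xs. set xs \<subseteq> \<Union>\<I>}"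

definition sum_left_nil_ideals :: "'a::ring set" where
  "sum_left_nil_ideals = sum_of_ideals {I. left_nil_ideal I}"

definition upper_nilradical :: "'a::ring set" where
  "upper_nilradical = sum_of_ideals {I. two_sided_nil_ideal I}"

end

theory Submission
  imports Defs
begin

text \<open>The upper nilradical \<open>Q\<close> is a semiprime nil ideal, so it suffices that \<open>x \<in> Q\<close> whenever all
  elements of \<open>R x\<close> are nilpotent. The closed sets \<open>{r. (r x)\<^sup>n = 0}\<close> cover \<open>R\<close>, so by Baire one of them
  contains a neighbourhood of some \<open>r\<^sub>0\<close>, and by compactness this neighbourhood contains
  \<open>r\<^sub>0 + I\<close> with \<open>I\<close> a neighbourhood of \<open>0\<close> that absorbs multiplication from both sides
  (it need not be additively closed). As \<open>r\<^sub>0 x\<close> is nilpotent, a descending induction on \<open>j\<close> shows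
  \<open>I (x r\<^sub>0)\<^sup>j x \<subseteq> Q\<close>: modulo \<open>Q\<close> each step meets only nil left ideals of bounded index, which vanish
  in a semiprime ring by Levitzki's theorem. Hence \<open>I x \<subseteq> Q\<close>. Compactness bounds the \<open>k\<close> for which
  \<open>(r x)\<^sup>k \<in> I\<close>, so \<open>R x\<close> has bounded index modulo \<open>Q\<close>, and Levitzki's theorem gives \<open>x \<in> Q\<close>.\<close>

section \<open>Powers in rings without a unit\<close>

text \<open>\<open>pow_mult y n w\<close> is \<open>y\<^sup>n w\<close>; unlike \<^const>\<open>pow_Suc\<close> it allows \<open>n = 0\<close> without a unit.\<close>

primrec pow_mult :: "'a::semigroup_mult \<Rightarrow> nat \<Rightarrow> 'a \<Rightarrow> 'a" where
  "pow_mult y 0 w = w"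
| "pow_mult y (Suc n) w = y * pow_mult y n w"

lemma pow_Suc_eq_pow_mult: "pow_Suc y n = pow_mult y n y"
  by (induction n) auto

lemma pow_mult_assoc: "pow_mult y n v * w = pow_mult y n (v * w)"
  by (induction n) (auto simp: mult.assoc)

lemma pow_mult_commute: "pow_mult y n (y * w) = y * pow_mult y n w"
  by (induction n) auto

lemma pow_Suc_mult: "pow_Suc y n * w = pow_mult y (Suc n) w"
  by (simp add: pow_Suc_eq_pow_mult pow_mult_assoc pow_mult_commute)

lemma pow_mult_pow_mult: "pow_mult y m (pow_mult y n w) = pow_mult y (m + n) w"
  by (induction m) auto

lemma mult_pow_mult_swap: "c * pow_mult (r * c) n v = pow_mult (c * r) n (c * v)"
  by (induction n) (auto simp: mult.assoc)

lemma pow_mult_add: "pow_mult y n (v + w) = pow_mult y n v + pow_mult y n (w :: 'a::ring)"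
  by (induction n) (auto simp: algebra_simps)

lemma mult_pow_Suc_swap: "c * pow_Suc (r * c) n = pow_mult (c * r) (Suc n) c"
  by (simp add: pow_Suc_eq_pow_mult mult_pow_mult_swap pow_mult_commute mult.assoc[symmetric])

text \<open>The exponent reflects (m + 1)(n + 1) = (m + n + m n) + 1.\<close>

lemma pow_Suc_pow_Suc: "pow_Suc (pow_Suc y m) n = pow_Suc y (m + n + m * n)"
proof (induction n)
  case (Suc n)
  have "pow_Suc (pow_Suc y m) (Suc n) = pow_mult y (Suc m) (pow_Suc y (m + n + m * n))"
    using Suc by (simp add: pow_Suc_mult del: pow_mult.simps)
  also have "\<dots> = pow_Suc y (m + Suc n + m * Suc n)"
    unfolding pow_Suc_eq_pow_mult pow_mult_pow_mult by (simp add: ac_simps)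
  finally show ?case .
qed simp

lemma nilpotent_pow_Suc: "nilpotent (pow_Suc y n) \<Longrightarrow> nilpotent y"
  unfolding nilpotent_def by (auto simp: pow_Suc_pow_Suc)

section \<open>Semiprime ideals and Levitzki's theorem\<close>

locale ring_ideal =
  fixes Q :: "'a::ring set"
  assumes zero: "0 \<in> Q"
    and add: "\<And>x y. x \<in> Q \<Longrightarrow> y \<in> Q \<Longrightarrow> x + y \<in> Q"
    and minus: "\<And>x. x \<in> Q \<Longrightarrow> - x \<in> Q"
    and lmult: "\<And>r x. x \<in> Q \<Longrightarrow> r * x \<in> Q"
    and rmult: "\<And>r x. x \<in> Q \<Longrightarrow> x * r \<in> Q"
begin

lemma diff: "x \<in> Q \<Longrightarrow> y \<in> Q \<Longrightarrow> x - y \<in> Q"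
  using add[of x "- y"] minus[of y] by simp

lemma add_cancel_right: "x + y \<in> Q \<Longrightarrow> y \<in> Q \<Longrightarrow> x \<in> Q"
  using diff[of "x + y" y] by simp

lemma add_cancel_left: "x + y \<in> Q \<Longrightarrow> x \<in> Q \<Longrightarrow> y \<in> Q"
  using diff[of "x + y" x] by simp

lemma pow_mult_closed: "w \<in> Q \<Longrightarrow> pow_mult y n w \<in> Q"
  by (induction n) (auto intro: lmult)

lemma pow_mult_mono: "pow_mult y m w \<in> Q \<Longrightarrow> m \<le> n \<Longrightarrow> pow_mult y n w \<in> Q"
  using pow_mult_closed[of "pow_mult y m w" y "n - m"] by (simp add: pow_mult_pow_mult)

text \<open>Behind a leading \<open>u\<close>, every summand in which \<open>a\<close> comes next
  dies modulo \<open>Q\<close>; by induction only the pure power of \<open>u\<close>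
  survives.\<close>

lemma mult_add_pow_mult_cong:
  assumes "\<And>j. u * (a * pow_mult (a + u) j v) \<in> Q"
  shows "u * pow_mult (a + u) j v - pow_mult u (Suc j) v \<in> Q"
proof (induction j)
  case 0
  show ?case by (simp add: zero)
next
  case (Suc j)
  have "u * pow_mult (a + u) (Suc j) v - pow_mult u (Suc (Suc j)) v
      = u * (a * pow_mult (a + u) j v) + u * (u * pow_mult (a + u) j v - pow_mult u (Suc j) v)"
    by (simp add: algebra_simps)
  then show ?case using assms Suc by (metis add lmult)
qed

end

lemma ring_ideal_iff: "ring_ideal Q \<longleftrightarrow> two_sided_ideal Q"
  unfolding ring_ideal_def two_sided_ideal_def additive_subgroup_def by blast

locale semiprime_ideal = ring_ideal +
  assumes semiprime: "(\<And>r. a * r * a \<in> Q) \<Longrightarrow> a \<in> Q"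
begin

text \<open>Levitzki's theorem on one-sided nil ideals of bounded index. With \<open>t = c r\<close> and
  \<open>b = t\<^sup>n c\<close>, expanding \<open>(t + c s t\<^sup>n)\<^sup>n\<^sup>+\<^sup>1 c \<in> Q\<close> and multiplying by \<open>t\<^sup>n\<^sup>-\<^sup>1\<close>
  leaves \<open>(b s)\<^sup>n b \<in> Q\<close>, so that the induction hypothesis applies first to \<open>b\<close>, then to \<open>c\<close>.\<close>

lemma levitzki_pow_mult:
  assumes "\<And>r. pow_mult (c * r) n c \<in> Q"
  shows "c \<in> Q"
  using assms
proof (induction n arbitrary: c)
  case 0
  then show ?case by simp
next
  case (Suc n)
  note IH = Suc.IH and H = Suc.prems
  show ?case
  proof (cases n)
    case 0
    show ?thesis
      by (rule semiprime) (use H 0 in simp)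
  next
    case (Suc k)
    have "pow_mult (c * r) n c \<in> Q" for r
    proof (rule IH)
      fix s
      define t where "t = c * r"
      \<comment> \<open>As \<open>n = Suc k\<close>, \<open>pow_Suc t k\<close> is t^n. Hence t + m
        = c (r + s t^n) has the form required by \<open>H\<close>.\<close>
      define m where "m = c * (s * pow_Suc t k)"
      define A where "A j = pow_mult (t + m) j c" for j
      have m_mult: "m * v = c * (s * pow_mult t n v)" for v
        unfolding m_def by (simp only: mult.assoc pow_Suc_mult Suc)
      have A_Suc: "A (Suc j) = t * A j + m * A j" for j
        by (simp add: A_def algebra_simps)
      have tc: "pow_mult t (Suc n) (c * v) \<in> Q" for v
        using rmult[OF H[of r], of v] by (simp only: t_def pow_mult_assoc)
      have tA: "pow_mult t (Suc n) (A j) \<in> Q" for j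
      proof (induction j)
        case 0
        show ?case using H[of r] by (simp only: A_def t_def pow_mult.simps(1))
      next
        case (Suc j)
        have "pow_mult t (Suc n) (m * A j) \<in> Q"
          unfolding m_mult by (rule tc)
        moreover have "pow_mult t (Suc n) (t * A j) \<in> Q"
          unfolding pow_mult_commute by (rule lmult[OF Suc])
        ultimately show ?case by (metis A_Suc pow_mult_add add)
      qed
      have mtA: "m * (t * A j) \<in> Q" for j
        using tA[of j] by (simp add: m_mult pow_mult_commute lmult)
      have mA: "m * A j - pow_mult m (Suc j) c \<in> Q" for j
        using mult_add_pow_mult_cong[of m t c j] mtA unfolding A_def by blast
      have "pow_mult m (Suc n) c \<in> Q"
        unfolding m_def by (rule H)
      then have mAn: "m * A n \<in> Q"
        using add[OF mA[of n], of "pow_mult m (Suc n) c"] by simp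
      have "A (Suc n) \<in> Q"
        using H[of "r + s * pow_Suc t k"] by (simp only: A_def t_def m_def distrib_left)
      then have "t * A n \<in> Q"
        using add_cancel_right mAn by (simp add: A_Suc)
      \<comment> \<open>With t^k in front, splitting \<open>A n = A (Suc k)\<close> gives t^(n+1)
        \<open>A k\<close>, which lies in \<open>Q\<close>, plus t^n m \<open>A k\<close>, which is
        t^n m^n c modulo \<open>Q\<close>.\<close>
      then have "pow_mult t k (t * A n) \<in> Q"
        by (rule pow_mult_closed)
      then have "pow_mult t n (A (Suc k)) \<in> Q"
        by (simp add: Suc pow_mult_commute)
      then have "pow_mult t n (t * A k) + pow_mult t n (m * A k) \<in> Q"
        by (simp only: A_Suc pow_mult_add)
      moreover have "pow_mult t n (t * A k) \<in> Q"
        using tA[of k] by (simp add: pow_mult_commute)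
      ultimately have "pow_mult t n (m * A k) \<in> Q"
        by (rule add_cancel_left)
      moreover have "pow_mult t n (m * A k - pow_mult m n c) \<in> Q"
        using mA[of k] Suc by (intro pow_mult_closed) simp
      moreover have "pow_mult t n (m * A k - pow_mult m n c) + pow_mult t n (pow_mult m n c)
          = pow_mult t n (m * A k)"
        by (simp only: pow_mult_add[symmetric] diff_add_cancel)
      ultimately have "pow_mult t n (pow_mult m n c) \<in> Q"
        using add_cancel_left by metis
      \<comment> \<open>Regrouping the factors m = c s t^n turns t^n m^j c into (b s)^j b with b =
        t^n c.\<close>
      moreover have "pow_mult t n (pow_mult m j c) = pow_mult (pow_mult t n c * s) j (pow_mult t n c)" for j
        by (induction j) (simp_all add: m_mult mult.assoc pow_mult_assoc[symmetric])
      ultimately show "pow_mult (pow_mult (c * r) n c * s) n (pow_mult (c * r) n c) \<in> Q"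
        by (simp only: t_def)
    qed
    then show ?thesis by (rule IH)
  qed
qed

text \<open>Left multiplication by \<open>c\<close> turns (r c)^(n+1) into (c r)^(n+1) c, which
  reduces this form to the previous one.\<close>

lemma levitzki:
  assumes "\<And>r. pow_Suc (r * c) n \<in> Q"
  shows "c \<in> Q"
proof (rule levitzki_pow_mult)
  show "pow_mult (c * r) (Suc n) c \<in> Q" for r
    using lmult[OF assms[of r], of c] by (simp only: mult_pow_Suc_swap)
qed

end

section \<open>The upper nilradical\<close>

text \<open>Powers of \<open>x + y\<close> and \<open>x\<close> agree modulo \<open>J\<close>, so
  some power of \<open>x + y\<close> lies in \<open>J\<close> and is itself nilpotent.\<close>

lemma nilpotent_add_mem_nil_ideal:
  assumes "nilpotent x" and J: "two_sided_nil_ideal J" and y: "y \<in> J"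
  shows "nilpotent (x + y)"
proof -
  interpret J: ring_ideal J
    using J by (simp add: ring_ideal_iff two_sided_nil_ideal_def)
  have diff: "pow_Suc (x + y) n - pow_Suc x n \<in> J" for n
  proof (induction n)
    case 0
    then show ?case using y by simp
  next
    case (Suc n)
    have "pow_Suc (x + y) (Suc n) - pow_Suc x (Suc n)
        = x * (pow_Suc (x + y) n - pow_Suc x n) + y * pow_Suc (x + y) n"
      by (simp add: algebra_simps)
    then show ?case using Suc y by (metis J.add J.lmult J.rmult)
  qed
  obtain n where "pow_Suc x n = 0"
    using assms(1) by (auto simp: nilpotent_def)
  then have "pow_Suc (x + y) n \<in> J"
    using diff[of n] by simp
  then show ?thesis
    using J nilpotent_pow_Suc by (auto simp: two_sided_nil_ideal_def)
qed

lemma two_sided_nil_ideal_sum: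
  assumes I: "two_sided_nil_ideal I" and J: "two_sided_nil_ideal J"
  shows "two_sided_nil_ideal {x + y | x y. x \<in> I \<and> y \<in> J}" (is "two_sided_nil_ideal ?S")
proof -
  interpret I: ring_ideal I
    using I by (simp add: ring_ideal_iff two_sided_nil_ideal_def)
  interpret J: ring_ideal J
    using J by (simp add: ring_ideal_iff two_sided_nil_ideal_def)
  have "ring_ideal ?S"
  proof
    show "0 \<in> ?S" using I.zero J.zero by force
    show "u + v \<in> ?S" if "u \<in> ?S" "v \<in> ?S" for u v
    proof -
      from that obtain a b c d where "u = a + b" "v = c + d" "a \<in> I" "c \<in> I" "b \<in> J" "d \<in> J"
        by blast
      then show ?thesis using I.add J.add
        by (intro CollectI exI[of _ "a + c"] exI[of _ "b + d"]) simp
    qed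
    show "- u \<in> ?S" if "u \<in> ?S" for u
    proof -
      from that obtain a b where "u = a + b" "a \<in> I" "b \<in> J" by blast
      then show ?thesis using I.minus J.minus
        by (intro CollectI exI[of _ "- a"] exI[of _ "- b"]) simp
    qed
    show "r * u \<in> ?S" if "u \<in> ?S" for r u
      using that I.lmult J.lmult by (force simp: distrib_left)
    show "u * r \<in> ?S" if "u \<in> ?S" for r u
      using that I.rmult J.rmult by (force simp: distrib_right)
  qed
  then show ?thesis
    using I J nilpotent_add_mem_nil_ideal
    by (auto simp: two_sided_nil_ideal_def ring_ideal_iff)
qed

text \<open>A sum of two nil ideals is nil, so every finite sum already lies in a single nil
  ideal.\<close>

lemma upper_nilradical_eq_Union: "upper_nilradical = \<Union>{I. two_sided_nil_ideal (I :: 'a::ring set)}"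
proof
  show "\<Union>{I. two_sided_nil_ideal (I :: 'a set)} \<subseteq> upper_nilradical"
  proof
    fix x :: 'a assume "x \<in> \<Union>{I. two_sided_nil_ideal I}"
    then show "x \<in> upper_nilradical"
      unfolding upper_nilradical_def sum_of_ideals_def
      by (intro CollectI exI[of _ "[x]"]) auto
  qed
  have "sum_list xs \<in> \<Union>{I. two_sided_nil_ideal I}"
    if "set xs \<subseteq> \<Union>{I. two_sided_nil_ideal I}" for xs :: "'a list"
    using that
  proof (induction xs)
    case Nil
    have "two_sided_nil_ideal {0 :: 'a}"
      by (auto simp: two_sided_nil_ideal_def two_sided_ideal_def additive_subgroup_def
          nilpotent_def intro: exI[of _ 0])
    then show ?case by auto
  next
    case (Cons x xs)
    then obtain I J where "two_sided_nil_ideal I" "x \<in> I" "two_sided_nil_ideal J" "sum_list xs \<in> J"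
      by auto
    then show ?case
      using two_sided_nil_ideal_sum[of I J] by auto
  qed
  then show "upper_nilradical \<subseteq> \<Union>{I. two_sided_nil_ideal (I :: 'a set)}"
    by (auto simp: upper_nilradical_def sum_of_ideals_def)
qed

lemma nilpotent_upper_nilradical: "x \<in> upper_nilradical \<Longrightarrow> nilpotent x"
  by (auto simp: upper_nilradical_eq_Union two_sided_nil_ideal_def)

lemma sum_list_upper_nilradical:
  assumes "set xs \<subseteq> upper_nilradical"
  shows "sum_list xs \<in> upper_nilradical"
proof -
  have "set xs \<subseteq> \<Union>{I. two_sided_nil_ideal I}"
    using assms by (simp only: upper_nilradical_eq_Union)
  then show ?thesis
    by (auto simp: upper_nilradical_def sum_of_ideals_def)
qed

text \<open>Without a unit, an explicit formula would combine Za, Ra, aR and RaR; closure rules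
  provide induction instead.\<close>

inductive_set generated_ideal :: "'a::ring \<Rightarrow> 'a set" for a where
  base: "a \<in> generated_ideal a"
| add: "x \<in> generated_ideal a \<Longrightarrow> y \<in> generated_ideal a \<Longrightarrow> x + y \<in> generated_ideal a"
| minus: "x \<in> generated_ideal a \<Longrightarrow> - x \<in> generated_ideal a"
| lmult: "x \<in> generated_ideal a \<Longrightarrow> r * x \<in> generated_ideal a"
| rmult: "x \<in> generated_ideal a \<Longrightarrow> x * r \<in> generated_ideal a"

lemma ring_ideal_generated_ideal: "ring_ideal (generated_ideal a)"
proof
  show "0 \<in> generated_ideal a"
    using generated_ideal.add[OF generated_ideal.base generated_ideal.minus[OF generated_ideal.base], of a] by simp
qed (auto intro: generated_ideal.intros)

text \<open>If a R a lies in the nilradical, then so does J R J for the ideal J generated by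
  \<open>a\<close>. Cubes of elements of J are thus nilpotent, and J is nil.\<close>

interpretation upper_nilradical: semiprime_ideal "upper_nilradical :: 'a::ring set"
proof -
  interpret N: ring_ideal "upper_nilradical :: 'a set"
  proof
    show "(0 :: 'a) \<in> upper_nilradical"
      using sum_list_upper_nilradical[of "[]"] by simp
    show "x + y \<in> upper_nilradical" if "x \<in> upper_nilradical" "y \<in> upper_nilradical" for x y :: 'a
      using sum_list_upper_nilradical[of "[x, y]"] that by simp
  next
    fix r x :: 'a
    assume "x \<in> upper_nilradical"
    then obtain I where I: "two_sided_nil_ideal I" "x \<in> I"
      by (auto simp: upper_nilradical_eq_Union)
    then have "- x \<in> I \<and> r * x \<in> I \<and> x * r \<in> I"
      by (simp add: two_sided_nil_ideal_def two_sided_ideal_def additive_subgroup_def)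
    with I(1) show "- x \<in> upper_nilradical" "r * x \<in> upper_nilradical" "x * r \<in> upper_nilradical"
      by (auto simp: upper_nilradical_eq_Union)
  qed
  show "semiprime_ideal (upper_nilradical :: 'a set)"
  proof
    fix a :: 'a
    assume a: "\<And>r. a * r * a \<in> upper_nilradical"
    have 1: "a * r * w \<in> upper_nilradical" if "w \<in> generated_ideal a" for r w
      using that
    proof (induction w arbitrary: r)
      case (lmult x s)
      show ?case using lmult.IH[of "r * s"] by (simp add: mult.assoc)
    next
      case (rmult x s)
      show ?case using N.rmult[OF rmult.IH[of r], of s] by (simp add: mult.assoc)
    qed (auto simp: a distrib_left intro: N.add N.minus)
    have 2: "u * r * w \<in> upper_nilradical" if "u \<in> generated_ideal a" "w \<in> generated_ideal a" for u r w
      using that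
    proof (induction u arbitrary: r)
      case (lmult x s)
      show ?case using N.lmult[OF lmult.IH[of r], of s] lmult.prems by (simp add: mult.assoc)
    next
      case (rmult x s)
      show ?case using rmult.IH[of "s * r"] rmult.prems by (simp add: mult.assoc)
    qed (auto simp: 1 distrib_right intro: N.add N.minus)
    have "nilpotent u" if "u \<in> generated_ideal a" for u
    proof (rule nilpotent_pow_Suc)
      \<comment> \<open>\<open>pow_Suc u 2\<close> is the cube of \<open>u\<close>.\<close>
      show "nilpotent (pow_Suc u 2)"
        using 2[OF that that, of u] nilpotent_upper_nilradical
        by (simp add: numeral_2_eq_2 mult.assoc)
    qed
    then have "two_sided_nil_ideal (generated_ideal a)"
      using ring_ideal_generated_ideal[of a] by (simp add: two_sided_nil_ideal_def ring_ideal_iff)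
    then show "a \<in> upper_nilradical"
      using generated_ideal.base[of a] by (auto simp: upper_nilradical_eq_Union)
  qed
qed


section \<open>Neighbourhoods of zero and Baire category in compact rings\<close>

lemma continuous_on_pow_Suc:
  fixes f :: "'b::topological_space \<Rightarrow> 'a::topological_semigroup_mult"
  assumes "continuous_on S f"
  shows "continuous_on S (\<lambda>x. pow_Suc (f x) n)"
proof (induction n)
  case 0
  then show ?case using assms by simp
next
  case (Suc n)
  then show ?case using assms by (auto intro: continuous_on_mult')
qed

text \<open>The tube lemma around {0} \<times> R makes the neighbourhood uniform in
  \<open>r\<close>.\<close>

lemma compact_mult_nhd:
  fixes U :: "'a::{ring, topological_semigroup_mult} set"
  assumes "compact (UNIV :: 'a set)" "open U" "0 \<in> U"
  obtains V where "open V" "0 \<in> V" "V \<subseteq> U" "\<And>r v. v \<in> V \<Longrightarrow> r * v \<in> U \<and> v * r \<in> U"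
proof -
  have "continuous_on UNIV (\<lambda>p :: 'a \<times> 'a. snd p * fst p)"
    "continuous_on UNIV (\<lambda>p :: 'a \<times> 'a. fst p * snd p)"
    by (intro continuous_intros)+
  then have "open ((\<lambda>p. snd p * fst p) -` U \<inter> (\<lambda>p. fst p * snd p) -` U)"
    using \<open>open U\<close> by (intro open_Int open_vimage)
  moreover have "{0} \<times> UNIV \<subseteq> (\<lambda>p. snd p * fst p) -` U \<inter> (\<lambda>p. fst p * snd p) -` U"
    using \<open>0 \<in> U\<close> by auto
  ultimately obtain V where V: "0 \<in> V" "open V"
      "V \<times> UNIV \<subseteq> (\<lambda>p. snd p * fst p) -` U \<inter> (\<lambda>p. fst p * snd p) -` U"
    using Elementary_Topology.tube_lemma[OF assms(1)] by blast
  show thesis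
  proof (rule that[of "V \<inter> U"])
    show "open (V \<inter> U)" using V(2) \<open>open U\<close> by (rule open_Int)
    show "r * v \<in> U \<and> v * r \<in> U" if "v \<in> V \<inter> U" for r v
    proof -
      have "(v, r) \<in> V \<times> UNIV" using that by simp
      from subsetD[OF V(3) this] show ?thesis by simp
    qed
    show "0 \<in> V \<inter> U" using V(1) \<open>0 \<in> U\<close> by (rule IntI)
  qed (rule Int_lower2)
qed

lemma compact_multiplicative_ideal_nhd:
  fixes U :: "'a::{ring, topological_semigroup_mult} set"
  assumes "compact (UNIV :: 'a set)" "open U" "0 \<in> U"
  obtains V I where "open V" "0 \<in> V" "V \<subseteq> I" "I \<subseteq> U"
    "\<And>r x. x \<in> I \<Longrightarrow> r * x \<in> I" "\<And>r x. x \<in> I \<Longrightarrow> x * r \<in> I"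
proof -
  obtain W where W: "open W" "0 \<in> W" "W \<subseteq> U" "\<And>r v. v \<in> W \<Longrightarrow> r * v \<in> U \<and> v * r \<in> U"
    using compact_mult_nhd[OF assms] by blast
  obtain V where V: "open V" "0 \<in> V" "V \<subseteq> W" "\<And>r v. v \<in> V \<Longrightarrow> r * v \<in> W \<and> v * r \<in> W"
    using compact_mult_nhd[OF assms(1) W(1,2)] by blast
  \<comment> \<open>This is the largest subset of \<open>U\<close> absorbing multiplication from
    both sides; two uniform shrinkings place \<open>V\<close> inside it.\<close>
  define I where "I = {x \<in> U. (\<forall>r. r * x \<in> U \<and> x * r \<in> U) \<and> (\<forall>r s. r * x * s \<in> U)}"
  show thesis
  proof (rule that[of V I])
    show "V \<subseteq> I"
      using V(3,4) W(3,4) unfolding I_def by blast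
    show "r * x \<in> I" if "x \<in> I" for r x
      using that unfolding I_def by (auto simp: mult.assoc) (simp_all add: mult.assoc[symmetric])
    show "x * r \<in> I" if "x \<in> I" for r x
      using that unfolding I_def by (auto simp: mult.assoc)
  qed (use V in \<open>auto simp: I_def\<close>)
qed

lemma compact_Baire:
  fixes F :: "nat \<Rightarrow> 'a::t2_space set"
  assumes "compact (UNIV :: 'a set)" "\<And>n. closed (F n)" "(\<Union>n. F n) = UNIV"
  obtains n where "interior (F n) \<noteq> {}"
proof -
  have "compact_space (euclidean :: 'a topology)"
    using assms(1) by (simp add: compact_space_def)
  moreover have "Hausdorff_space (euclidean :: 'a topology)"
    using hausdorff by (fastforce simp: Hausdorff_space_def disjnt_def)
  ultimately have "locally_compact_space (euclidean :: 'a topology)" "regular_space (euclidean :: 'a topology)"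
    by (auto intro: compact_imp_locally_compact_space compact_Hausdorff_imp_regular_space)
  then have "\<exists>n. interior (F n) \<noteq> {}"
    using Baire_category_alt[of euclidean "range F"] assms(2,3) by auto
  then show thesis using that by blast
qed

section \<open>From nilpotent left multiples to the semiprime ideal\<close>

lemma mem_semiprime_ideal_if_left_multiples_nilpotent:
  fixes x :: "'a::{ring, topological_ab_group_add, topological_semigroup_mult, t2_space}"
  assumes comp: "compact (UNIV :: 'a set)"
    and Q: "semiprime_ideal Q"
    and nil: "\<And>r. nilpotent (r * x)"
  shows "x \<in> Q"
proof -
  interpret semiprime_ideal Q by (fact Q)
  have cont: "continuous_on UNIV (\<lambda>r. pow_Suc (r * x) n)" for n
    by (intro continuous_on_pow_Suc) (intro continuous_intros)
  define F where "F n = {r. pow_Suc (r * x) n = 0}" for n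
  have "closed (F n)" for n
    using continuous_closed_vimage[of "{0}" "\<lambda>r. pow_Suc (r * x) n"] cont[of n]
    by (auto simp: F_def vimage_def continuous_on_eq_continuous_within)
  moreover have "(\<Union>n. F n) = UNIV"
    using nil by (auto simp: F_def nilpotent_def)
  ultimately obtain n where "interior (F n) \<noteq> {}"
    using compact_Baire[OF comp] by blast
  then obtain r0 where r0: "r0 \<in> interior (F n)" by blast
  define U where "U = (\<lambda>u. r0 + u) -` interior (F n)"
  have "open U"
    unfolding U_def by (intro open_vimage) (auto intro!: continuous_intros)
  moreover have "0 \<in> U"
    using r0 by (simp add: U_def)
  ultimately obtain V I where V: "open V" "0 \<in> V" "V \<subseteq> I" and IU: "I \<subseteq> U"
    and I_lmult: "\<And>r h. h \<in> I \<Longrightarrow> r * h \<in> I" and I_rmult: "\<And>r h. h \<in> I \<Longrightarrow> h * r \<in> I"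
    using compact_multiplicative_ideal_nhd[OF comp] by metis
  have nil_I: "pow_Suc (r0 * x + h * x) n = 0" if "h \<in> I" for h
  proof -
    have "r0 + h \<in> F n"
      using that IU interior_subset unfolding U_def by blast
    then show ?thesis by (simp add: F_def distrib_right)
  qed
  define c where "c j = pow_mult (x * r0) j x" for j
  \<comment> \<open>Since \<open>c (Suc j) = x * r0 * c j\<close>, the factor \<open>x * r0\<close>
    can be absorbed into the element of \<open>I\<close>.\<close>
  have absorb: "\<exists>h'\<in>I. h' * x = h * c j" if "h \<in> I" for h j
    using that
  proof (induction j arbitrary: h)
    case 0
    then show ?case by (auto simp: c_def)
  next
    case (Suc j)
    from Suc.IH[OF I_rmult[OF Suc.prems, of "x * r0"]] show ?case
      by (simp add: c_def mult.assoc)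
  qed
  obtain m where "pow_Suc (r0 * x) m = 0"
    using nil[of r0] by (auto simp: nilpotent_def)
  then have cm: "c (Suc m) = 0"
    unfolding c_def using mult_pow_Suc_swap[of x r0 m] by simp
  have descent: "\<forall>h\<in>I. h * c j \<in> Q" if step: "\<forall>h\<in>I. h * c (Suc j) \<in> Q" for j
  proof
    fix h0 assume "h0 \<in> I"
    show "h0 * c j \<in> Q"
    proof (rule levitzki[where n = "Suc n"])
      fix r
      have "r * h0 \<in> I" using \<open>h0 \<in> I\<close> by (rule I_lmult)
      then obtain h where h: "h \<in> I" "h * x = r * h0 * c j"
        using absorb by blast
      \<comment> \<open>Here u r0 x = r h0 \<open>c (Suc j)\<close> lies in \<open>Q\<close>.
        Expanding u (r0 x + u)^(n+1) = 0 therefore leaves u^(n+2) in \<open>Q\<close>, a bound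
        independent of \<open>r\<close>.\<close>
      define u where "u = h * x"
      have "c j * (r0 * x) = c (Suc j)"
        by (simp add: c_def pow_mult_assoc mult.assoc[symmetric] pow_mult_commute flip: pow_mult.simps(2))
      then have "u * (r0 * x) \<in> Q"
        using step \<open>h0 \<in> I\<close> lmult by (simp add: u_def h(2) mult.assoc)
      then have "u * (r0 * x * w) \<in> Q" for w
        using rmult by (simp add: mult.assoc[symmetric])
      then have "u * pow_mult (r0 * x + u) n (r0 * x + u) - pow_mult u (Suc n) (r0 * x + u) \<in> Q"
        by (intro mult_add_pow_mult_cong)
      moreover have "pow_mult (r0 * x + u) n (r0 * x + u) = 0"
        using nil_I[OF h(1)] by (simp add: u_def pow_Suc_eq_pow_mult)
      ultimately have "pow_mult u (Suc n) (r0 * x + u) \<in> Q"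
        using minus by fastforce
      then have "pow_mult u (Suc n) (r0 * x) + pow_mult u (Suc n) u \<in> Q"
        by (simp only: pow_mult_add)
      moreover have "pow_mult u (Suc n) (r0 * x) \<in> Q"
        using pow_mult_closed[OF \<open>u * (r0 * x) \<in> Q\<close>, of u n] by (simp add: pow_mult_commute)
      ultimately have "pow_mult u (Suc n) u \<in> Q"
        by (rule add_cancel_left)
      then show "pow_Suc (r * (h0 * c j)) (Suc n) \<in> Q"
        by (simp only: pow_Suc_eq_pow_mult u_def h(2) mult.assoc)
    qed
  qed
  have "\<forall>h\<in>I. h * c 0 \<in> Q"
  proof (rule inc_induct[of 0 "Suc m"])
    show "\<forall>h\<in>I. h * c (Suc m) \<in> Q" by (simp add: cm zero)
  qed (use descent in auto)
  then have Ix: "h * x \<in> Q" if "h \<in> I" for h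
    using that by (simp add: c_def)
  \<comment> \<open>The open set \<open>V\<close> replaces \<open>I\<close>, which is not known to
    be open, so that compactness yields a finite subcover.\<close>
  define G where "G k = (\<lambda>r. pow_Suc (r * x) k) -` V" for k
  have "open (G k)" for k
    unfolding G_def using V(1) cont by (rule open_vimage)
  moreover have "UNIV \<subseteq> (\<Union>k. G k)"
  proof
    fix r
    obtain k where "pow_Suc (r * x) k = 0"
      using nil[of r] by (auto simp: nilpotent_def)
    then have "r \<in> G k" using V(2) by (simp add: G_def)
    then show "r \<in> (\<Union>k. G k)" by blast
  qed
  ultimately obtain K where K: "finite K" "UNIV \<subseteq> (\<Union>k\<in>K. G k)"
    using compactE_image[OF comp, of UNIV G] by metis
  show ?thesis
  proof (rule levitzki[where n = "Suc (Max K)"])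
    fix r
    obtain k where k: "k \<in> K" "r \<in> G k" using K(2) by blast
    then have "pow_Suc (r * x) k \<in> I" using V(3) by (auto simp: G_def)
    \<comment> \<open>Absorbing \<open>r\<close> into \<open>I\<close> before applying
      \<open>Ix\<close> gives (r x)^(k+2) in \<open>Q\<close>, whence the index
      \<open>Suc (Max K)\<close>.\<close>
    then have "pow_Suc (r * x) k * r * x \<in> Q"
      using Ix I_rmult by blast
    then have "pow_mult (r * x) (Suc k) (r * x) \<in> Q"
      by (simp only: pow_Suc_mult pow_mult_assoc)
    then show "pow_Suc (r * x) (Suc (Max K)) \<in> Q"
      unfolding pow_Suc_eq_pow_mult
      by (rule pow_mult_mono) (use K(1) k(1) in simp)
  qed
qed

theorem mainTheorem1:
  assumes "compact (UNIV :: 'a::{ring, topological_ab_group_add, topological_semigroup_mult, t2_space} set)"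
  shows "(sum_left_nil_ideals :: 'a set) = upper_nilradical"
proof
  have "\<Union>{I :: 'a set. two_sided_nil_ideal I} \<subseteq> \<Union>{I. left_nil_ideal I}"
    by (intro Union_mono)
      (auto simp: two_sided_nil_ideal_def left_nil_ideal_def two_sided_ideal_def left_ideal_def)
  then show "(upper_nilradical :: 'a set) \<subseteq> sum_left_nil_ideals"
    unfolding upper_nilradical_def sum_left_nil_ideals_def sum_of_ideals_def by fast
  have "x \<in> upper_nilradical" if "left_nil_ideal L" "x \<in> L" for L and x :: 'a
  proof (rule mem_semiprime_ideal_if_left_multiples_nilpotent[OF assms])
    show "semiprime_ideal (upper_nilradical :: 'a set)"
      by (rule upper_nilradical.semiprime_ideal_axioms)
    show "nilpotent (r * x)" for r
      using that by (simp add: left_nil_ideal_def left_ideal_def)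
  qed
  then show "sum_left_nil_ideals \<subseteq> (upper_nilradical :: 'a set)"
    unfolding sum_left_nil_ideals_def sum_of_ideals_def
    using sum_list_upper_nilradical by fast
qed

end
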